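(* Suppose that the following conditions hold (for all $K\in\mathcal T$ and $0\le n\le N-1$): (1) $\eta>1$; (2) $\displaystyle\delta t\le\frac{|K|}{2\sum_{\sigma\in\mathcal E(K),\,\sigma=K|L}|\sigma|\bigl(-(w^n_{\sigma,K})^-\bigr)}$. Then any numerical solution of the limit scheme $[\mathcal P_0^{h_{\mathcal T}}]$ satisfies the local in-time energy inequality $$\frac12\sum_{K\in\mathcal T}|K|\,|\mathbf v_K^{n+1}|^2\le\frac12\sum_{K\in\mathcal T}|K|\,|\mathbf v_K^n|^2$$ for each $0\le n\le N-1$.
   Context: **Mesh.** $d\in\{2,3\}$; periodic boundary conditions, $\Omega=\mathbb T^d$. $\mathcal T$ is a finite family of closed axis-parallel (possibly non-uniform) rectangles/cuboids $K$ covering $\overline\Omega$; two distinct cells share no edge or exactly one edge $\sigma=K|L$. $\mathcal E(K)$: the edges (faces) of $K$; $\mathcal E_{ext}$: edges on $\partial\Omega$; $|K|,|\sigma|$: Lebesgue measures; $\boldsymbol\nu_{\sigma,K}$: unit normal to $\sigma$ outward from $K$. $\mathcal L_{\mathcal T}(\Omega)$ (resp. $\mathcal L_{\mathcal T}(\Omega;\mathbb R^d)$): scalar (vector) functions constant on each $K$ (value $q_K$); $(\Pi_{\mathcal T}q)_K=|K|^{-1}\int_Kq\,dx$; $\{\!\{q\}\!\}_\sigma=(q_K+q_L)/2$ for $\sigma=K|L$. **Discrete operators.** $w_{\sigma,K}=\{\!\{\mathbf w\}\!\}_\sigma\cdot\boldsymbol\nu_{\sigma,K}$ if $\sigma=K|L$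 and $0$ if $\sigma\in\mathcal E_{ext}$; $(\mathrm{div}_{\mathcal T}\mathbf w)_K=|K|^{-1}\sum_{\sigma\in\mathcal E(K)}|\sigma|w_{\sigma,K}$; $(\nabla_{\mathcal T}q)_K=|K|^{-1}\sum_{\sigma=K|L\in\mathcal E(K)}|\sigma|\frac{q_L-q_K}2\boldsymbol\nu_{\sigma,K}$; $(\mathrm{div}^{up}_{\mathcal T}(\mathbf q,\mathbf w))_K=|K|^{-1}\sum_{\sigma=K|L\in\mathcal E(K)}|\sigma|\{\mathbf q_K(w_{\sigma,K})^++\mathbf q_L(w_{\sigma,K})^-\}$. Write $a^\pm=(a\pm|a|)/2$. **Limit scheme $[\mathcal P_0^{h_{\mathcal T}}]$.** $t^n=n\,\delta t$, $t^N=T$; $\mathbf v^0=\Pi_{\mathcal T}\mathbf v_0$. For $0\le n\le N-1$, $(\mathbf v^{n+1},\pi^{n+1})\in\mathcal L_{\mathcal T}(\Omega;\mathbb R^d)\times\mathcal L_{\mathcal T}(\Omega)$ satisfies for all $K\in\mathcal T$ $(\mathrm{div}_{\mathcal T}(\mathbf v^n-\delta\mathbf v^{n+1}))_K=0$, $\frac1{\delta t}(\mathbf v_K^{n+1}-\mathbf v_K^n)+(\mathrm{div}^{up}_{\mathcal T}(\mathbf v^n,\mathbf v^n-\delta\mathbf v^{n+1}))_K+(\nabla_{\mathcal T}\pi^{n+1})_K=0$, with $\delta\mathbf v^{n+1}_K=\eta\,\delta t(\nabla_{\mathcal T}\pi^{n+1})_K$, $\eta>0$ a constant. Here $\mathbf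 w^n=\mathbf v^n-\delta\mathbf v^{n+1}$ and $(w^n_{\sigma,K})^+=v_{\sigma,K}^{n,+}-\delta v_{\sigma,K}^{n+1,-}\ge0$, $(w^n_{\sigma,K})^-=v_{\sigma,K}^{n,-}-\delta v_{\sigma,K}^{n+1,+}\le0$. *)

theory Defs
  imports "HOL-Analysis.Analysis"
begin

section \<open>The torus\<close>

text \<open>
  The torus is the quotient of the Euclidean space \<open>'a\<close> by the lattice whose period in the
  coordinate direction \<open>b\<close> is \<open>l \<bullet> b\<close>; the choice \<open>l = \<Sum>Basis\<close> gives the unit torus.
  A subset of the torus is represented by its preimage in \<open>'a\<close>, which is a lattice-invariant set.
  The torus has no boundary, so there are no exterior edges.
\<close>

definition periods :: "'a::euclidean_space \<Rightarrow> 'a set" where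
  "periods l = {k. \<forall>b\<in>Basis. \<exists>m::int. k \<bullet> b = of_int m * (l \<bullet> b)}"

definition on_torus :: "'a::euclidean_space \<Rightarrow> 'a set \<Rightarrow> 'a set" where
  "on_torus l S = {x + k |x k. x \<in> S \<and> k \<in> periods l}"

definition periodic_integrable :: "'a::euclidean_space \<Rightarrow> ('a \<Rightarrow> 'a) \<Rightarrow> bool" where
  "periodic_integrable l f \<longleftrightarrow>
     (\<forall>x. \<forall>k\<in>periods l. f (x + k) = f x) \<and> set_integrable lebesgue (cbox 0 l) f"


section \<open>Meshes of boxes\<close>

text \<open>
  A cell is given by a box \<open>K\<close> in \<open>'a\<close>, one fixed lift of the cell of the torus; an edge is a
  subset of the torus (an invariant set, see above), so that two cells which meet only after a
  translation by a period do share the corresponding edge.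
\<close>

definition axis_dirs :: "'a::euclidean_space set" where
  "axis_dirs = Basis \<union> uminus ` Basis"

definition face :: "'a::euclidean_space set \<Rightarrow> 'a \<Rightarrow> 'a set" where
  "face K u = {x\<in>K. \<forall>y\<in>K. y \<bullet> u \<le> x \<bullet> u}"

definition edges :: "'a::euclidean_space \<Rightarrow> 'a set \<Rightarrow> 'a set set" where
  "edges l K = {on_torus l (face K u) |u. u \<in> axis_dirs}"

definition periodic_mesh :: "'a::euclidean_space \<Rightarrow> 'a set set \<Rightarrow> bool" where
  "periodic_mesh l \<T> \<longleftrightarrow>
     (\<forall>b\<in>Basis. 0 < l \<bullet> b) \<and>
     finite \<T> \<and>
     (\<forall>K\<in>\<T>. \<exists>p q. K = cbox p q \<and> (\<forall>b\<in>Basis. p \<bullet> b < q \<bullet> b \<and> q \<bullet> b - p \<bullet> b < l \<bullet> b)) \<and>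
     (\<Union>K\<in>\<T>. on_torus l K) = UNIV \<and>
     (\<forall>K\<in>\<T>. \<forall>L\<in>\<T>. K \<noteq> L \<longrightarrow> interior (on_torus l K) \<inter> interior (on_torus l L) = {}) \<and>
     (\<forall>K\<in>\<T>. \<forall>L\<in>\<T>. K \<noteq> L \<longrightarrow>
        edges l K \<inter> edges l L = {} \<or> (\<exists>\<sigma>. edges l K \<inter> edges l L = {\<sigma>})) \<and>
     (\<forall>K\<in>\<T>. \<forall>\<sigma>\<in>edges l K. \<exists>L\<in>\<T>. L \<noteq> K \<and> \<sigma> \<in> edges l L)"

text \<open>
  For \<open>\<sigma> \<in> edges l K\<close> the direction \<open>normal l K \<sigma>\<close> is unique because the sides of \<open>K\<close> are
  shorter than the periods, and \<open>neighbour l \<T> K \<sigma>\<close> is unique because cells do not overlap: it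
  is the \<open>L\<close> with \<open>\<sigma> = K|L\<close>.
\<close>

definition normal :: "'a::euclidean_space \<Rightarrow> 'a set \<Rightarrow> 'a set \<Rightarrow> 'a" where
  "normal l K \<sigma> = (THE u. u \<in> axis_dirs \<and> \<sigma> = on_torus l (face K u))"

definition neighbour :: "'a::euclidean_space \<Rightarrow> 'a set set \<Rightarrow> 'a set \<Rightarrow> 'a set \<Rightarrow> 'a set" where
  "neighbour l \<T> K \<sigma> = (THE L. L \<in> \<T> \<and> L \<noteq> K \<and> \<sigma> \<in> edges l L)"

text \<open>
  The \<open>(d-1)\<close>-dimensional Lebesgue measure of a set contained in a hyperplane orthogonal to the
  coordinate direction \<open>u\<close>, computed in the remaining \<open>d-1\<close> coordinates. The measure of an edge
  is that of its lift, the face of \<open>K\<close>; the lift seen from the other cell is a translate.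
\<close>

definition hyperplane_measure :: "'a::euclidean_space \<Rightarrow> 'a set \<Rightarrow> real" where
  "hyperplane_measure u F =
     (let B = {b\<in>Basis. b \<bullet> u = 0}
      in measure (\<Pi>\<^sub>M b\<in>B. (lborel :: real measure)) ((\<lambda>x. \<lambda>b\<in>B. x \<bullet> b) ` F))"

definition edge_measure :: "'a::euclidean_space \<Rightarrow> 'a set \<Rightarrow> 'a set \<Rightarrow> real" where
  "edge_measure l K \<sigma> = hyperplane_measure (normal l K \<sigma>) (face K (normal l K \<sigma>))"


section \<open>Discrete operators\<close>

text \<open>
  A function that is constant on each cell is represented by the map from cells \<open>K\<close> to its
  values; only the values at \<open>K \<in> \<T>\<close> matter. In a periodic mesh every edge of \<open>K\<close> is of the
  form \<open>K|L\<close>, so \<open>edges l K\<close> is also the index set of the sums over interior edges.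
\<close>

definition cell_mean :: "('a::euclidean_space \<Rightarrow> 'a) \<Rightarrow> 'a set \<Rightarrow> 'a" where
  "cell_mean f K = (1 / measure lebesgue K) *\<^sub>R (LINT x:K|lebesgue. f x)"

definition pos :: "real \<Rightarrow> real" where
  "pos a = (a + \<bar>a\<bar>) / 2"

definition neg :: "real \<Rightarrow> real" where
  "neg a = (a - \<bar>a\<bar>) / 2"

definition flux ::
  "'a::euclidean_space \<Rightarrow> 'a set set \<Rightarrow> ('a set \<Rightarrow> 'a) \<Rightarrow> 'a set \<Rightarrow> 'a set \<Rightarrow> real" where
  "flux l \<T> w K \<sigma> = ((1/2) *\<^sub>R (w K + w (neighbour l \<T> K \<sigma>))) \<bullet> normal l K \<sigma>"

definition mesh_div ::
  "'a::euclidean_space \<Rightarrow> 'a set set \<Rightarrow> ('a set \<Rightarrow> 'a) \<Rightarrow> 'a set \<Rightarrow> real" where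
  "mesh_div l \<T> w K =
     (1 / measure lebesgue K) * (\<Sum>\<sigma>\<in>edges l K. edge_measure l K \<sigma> * flux l \<T> w K \<sigma>)"

definition mesh_grad ::
  "'a::euclidean_space \<Rightarrow> 'a set set \<Rightarrow> ('a set \<Rightarrow> real) \<Rightarrow> 'a set \<Rightarrow> 'a" where
  "mesh_grad l \<T> q K =
     (1 / measure lebesgue K) *\<^sub>R
       (\<Sum>\<sigma>\<in>edges l K.
          (edge_measure l K \<sigma> * ((q (neighbour l \<T> K \<sigma>) - q K) / 2)) *\<^sub>R normal l K \<sigma>)"

text \<open>
  The upwind divergence of \<open>q\<close>, where \<open>wp K \<sigma>\<close> and \<open>wm K \<sigma>\<close> are the nonnegative and the
  nonpositive part of the flux of the transporting field through \<open>\<sigma>\<close> out of \<open>K\<close>.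
\<close>

definition mesh_div_up ::
  "'a::euclidean_space \<Rightarrow> 'a set set \<Rightarrow> ('a set \<Rightarrow> 'a) \<Rightarrow> ('a set \<Rightarrow> 'a set \<Rightarrow> real) \<Rightarrow>
   ('a set \<Rightarrow> 'a set \<Rightarrow> real) \<Rightarrow> 'a set \<Rightarrow> 'a" where
  "mesh_div_up l \<T> q wp wm K =
     (1 / measure lebesgue K) *\<^sub>R
       (\<Sum>\<sigma>\<in>edges l K.
          edge_measure l K \<sigma> *\<^sub>R (wp K \<sigma> *\<^sub>R q K + wm K \<sigma> *\<^sub>R q (neighbour l \<T> K \<sigma>)))"


section \<open>The limit scheme\<close>

definition stab ::
  "'a::euclidean_space \<Rightarrow> 'a set set \<Rightarrow> real \<Rightarrow> real \<Rightarrow> ('a set \<Rightarrow> real) \<Rightarrow> 'a set \<Rightarrow> 'a" where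
  "stab l \<T> \<eta> \<delta>t q K = (\<eta> * \<delta>t) *\<^sub>R mesh_grad l \<T> q K"

text \<open>
  The two parts of the flux of \<open>v - dv\<close>. They add up to that flux and have the right signs, but
  in the scheme they are formed from the parts of the two separate fluxes, and in general they
  differ from \<open>pos\<close> and \<open>neg\<close> of the flux of \<open>v - dv\<close>.
\<close>

definition flux_pos ::
  "'a::euclidean_space \<Rightarrow> 'a set set \<Rightarrow> ('a set \<Rightarrow> 'a) \<Rightarrow> ('a set \<Rightarrow> 'a) \<Rightarrow>
   'a set \<Rightarrow> 'a set \<Rightarrow> real" where
  "flux_pos l \<T> v dv K \<sigma> = pos (flux l \<T> v K \<sigma>) - neg (flux l \<T> dv K \<sigma>)"

definition flux_neg ::
  "'a::euclidean_space \<Rightarrow> 'a set set \<Rightarrow> ('a set \<Rightarrow> 'a) \<Rightarrow> ('a set \<Rightarrow> 'a) \<Rightarrow>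
   'a set \<Rightarrow> 'a set \<Rightarrow> real" where
  "flux_neg l \<T> v dv K \<sigma> = neg (flux l \<T> v K \<sigma>) - pos (flux l \<T> dv K \<sigma>)"

definition limit_scheme ::
  "'a::euclidean_space \<Rightarrow> 'a set set \<Rightarrow> real \<Rightarrow> real \<Rightarrow> nat \<Rightarrow> ('a \<Rightarrow> 'a) \<Rightarrow>
   (nat \<Rightarrow> 'a set \<Rightarrow> 'a) \<Rightarrow> (nat \<Rightarrow> 'a set \<Rightarrow> real) \<Rightarrow> bool" where
  "limit_scheme l \<T> \<eta> \<delta>t N v0 v p \<longleftrightarrow>
     (\<forall>K\<in>\<T>. v 0 K = cell_mean v0 K) \<and>
     (\<forall>n<N. \<forall>K\<in>\<T>.
        let dv = stab l \<T> \<eta> \<delta>t (p (Suc n)) in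
          mesh_div l \<T> (\<lambda>L. v n L - dv L) K = 0 \<and>
          (1 / \<delta>t) *\<^sub>R (v (Suc n) K - v n K)
            + mesh_div_up l \<T> (v n) (flux_pos l \<T> (v n) dv) (flux_neg l \<T> (v n) dv) K
            + mesh_grad l \<T> (p (Suc n)) K = 0)"

text \<open>
  The bound \<open>\<delta>t \<le> |K| / (2 * S)\<close> is no restriction if the sum \<open>S \<ge> 0\<close> vanishes; this has to
  be said explicitly since \<open>x / 0 = 0\<close>.
\<close>

definition time_step_condition ::
  "'a::euclidean_space \<Rightarrow> 'a set set \<Rightarrow> real \<Rightarrow> real \<Rightarrow> ('a set \<Rightarrow> 'a) \<Rightarrow> ('a set \<Rightarrow> real) \<Rightarrow>
   'a set \<Rightarrow> bool" where
  "time_step_condition l \<T> \<eta> \<delta>t v q K \<longleftrightarrow>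
     (let S = (\<Sum>\<sigma>\<in>edges l K.
                 edge_measure l K \<sigma> * (- flux_neg l \<T> v (stab l \<T> \<eta> \<delta>t q) K \<sigma>))
      in S \<noteq> 0 \<longrightarrow> \<delta>t \<le> measure lebesgue K / (2 * S))"

end

theory Submission
  imports Defs
begin

text \<open>
  Since \<open>v - \<delta>v\<close> is discretely divergence free, \<open>|K|\<close> times the upwind term is
  \<open>A\<^sub>K = \<Sum>\<^sub>\<sigma> |\<sigma>| w\<^sup>- (v\<^sub>L - v\<^sub>K)\<close>. Tested with \<open>v\<^sub>K\<close> it produces half of the dissipation
  \<open>\<Sum>\<^sub>K D\<^sub>K\<close>, \<open>D\<^sub>K = \<Sum>\<^sub>\<sigma> |\<sigma>| (- w\<^sup>-) |v\<^sub>L - v\<^sub>K|\<^sup>2\<close>, because the remaining edge terms change sign when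
  an edge is seen from the other cell. By the duality of gradient and divergence the pressure
  term tested with \<open>v\<close> produces \<open>\<eta> \<delta>t \<Sum>\<^sub>K |K| |\<nabla>\<pi>|\<^sup>2\<close>. The remainder \<open>|v\<^sup>n\<^sup>+\<^sup>1 - v\<^sup>n|\<^sup>2\<close> is at most twice
  the sum of its upwind and pressure parts; Cauchy-Schwarz and the time step condition bound the
  former by the dissipation, and \<open>\<eta> > 1\<close> takes care of the latter.

  All this needs that the two cells at an edge see it with opposite normals and equal measures.
  A periodic box whose sides are shorter than the periods determines its lift up to a period;
  applied to the (degenerate) boxes that are faces, this shows that cells with a common edge and
  equal normals there overlap.
\<close>

section \<open>Periodic boxes\<close>

lemma periodic_interval_shift:
  fixes L a b c d :: real
  assumes "a \<le> b" "b - a < L" "c \<le> d" "d - c < L"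
    and eq: "{t + of_int m * L |t m. a \<le> t \<and> t \<le> b} = {t + of_int m * L |t m. c \<le> t \<and> t \<le> d}"
  shows "\<exists>m::int. c = a + of_int m * L \<and> d = b + of_int m * L"
proof -
  let ?A = "{t + of_int m * L |t m. a \<le> t \<and> t \<le> b}"
  let ?C = "{t + of_int m * L |t m. c \<le> t \<and> t \<le> d}"
  have L: "0 < L" using assms by linarith
  \<comment> \<open>The translates of \<open>{p..q}\<close> leave a gap just before \<open>p\<close> and just after \<open>q\<close>; comparing
    gaps identifies the endpoints.\<close>
  have gap: "t \<le> q - L \<or> p \<le> t" if t: "t \<in> {t + of_int m * L |t m. p \<le> t \<and> t \<le> q}" "t \<le> q"
    for p q t :: real
  proof -
    obtain s and m :: int where s: "t = s + of_int m * L" "p \<le> s" "s \<le> q" using t(1) by blast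
    show ?thesis
    proof (cases "0 \<le> m")
      case True
      then have "0 \<le> of_int m * L" using L by simp
      then show ?thesis using s t(2) by linarith
    next
      case False
      then have "real_of_int m \<le> -1" by linarith
      then have "of_int m * L \<le> (-1) * L" using L mult_right_mono less_imp_le by metis
      then show ?thesis using s t(2) by linarith
    qed
  qed
  have gap': "p + L \<le> t \<or> t \<le> q" if t: "t \<in> {t + of_int m * L |t m. p \<le> t \<and> t \<le> q}" "p \<le> t"
    for p q t :: real
  proof -
    obtain s and m :: int where s: "t = s + of_int m * L" "p \<le> s" "s \<le> q" using t(1) by blast
    show ?thesis
    proof (cases "m \<le> 0")
      case True
      then have "of_int m * L \<le> 0" using L by (simp add: mult_nonpos_nonneg)
      then show ?thesis using s t(2) by linarith
    next
      case False
      then have "1 \<le> real_of_int m" by linarith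
      then have "1 * L \<le> of_int m * L" using L mult_right_mono less_imp_le by metis
      then show ?thesis using s t(2) by linarith
    qed
  qed
  have base: "t \<in> {t + of_int m * L |t m. p \<le> t \<and> t \<le> q}" if "p \<le> t" "t \<le> q" for p q t :: real
    using that by (intro CollectI exI[of _ t] exI[of _ "0::int"]) auto
  have "a \<in> ?C" unfolding eq[symmetric] by (rule base) (use assms in auto)
  then obtain s and m :: int where s: "a = s + of_int m * L" "c \<le> s" "s \<le> d" by blast
  \<comment> \<open>Among the translates of the second interval, this is the copy that contains
    \<open>a\<close>; it remains to show that it coincides with \<open>{a..b}\<close>.\<close>
  define c' d' where "c' = c + of_int m * L" and "d' = d + of_int m * L"
  have eq': "?A = {t + of_int k * L |t k. c' \<le> t \<and> t \<le> d'}" (is "_ = ?C'")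
  proof -
    have "?C \<subseteq> ?C'"
    proof
      fix x assume "x \<in> ?C"
      then obtain t k where "x = t + of_int k * L" "c \<le> t" "t \<le> d" by auto
      then show "x \<in> ?C'"
        by (intro CollectI exI[of _ "t + of_int m * L"] exI[of _ "k - m"])
          (auto simp: c'_def d'_def algebra_simps)
    qed
    moreover have "?C' \<subseteq> ?C"
    proof
      fix x assume "x \<in> ?C'"
      then obtain t k where "x = t + of_int k * L" "c' \<le> t" "t \<le> d'" by auto
      then show "x \<in> ?C"
        by (intro CollectI exI[of _ "t - of_int m * L"] exI[of _ "k + m"])
          (auto simp: c'_def d'_def algebra_simps)
    qed
    ultimately show ?thesis using eq by simp
  qed
  have a: "c' \<le> a" "a \<le> d'" and len: "d' - c' < L" using s assms by (auto simp: c'_def d'_def)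
  have ac: "a = c'"
  proof (rule ccontr)
    assume "a \<noteq> c'"
    \<comment> \<open>A point slightly below \<open>a\<close> lies in the shifted copy but in the
      gap between \<open>b - L\<close> and \<open>a\<close> of the first family. The two cases below
      use the gaps after \<open>b\<close> and after \<open>d'\<close> in the same way.\<close>
    then have "max c' (b - L) < a" using a assms by auto
    then obtain t where t: "max c' (b - L) < t" "t < a" using dense by blast
    then have "t \<in> ?A" unfolding eq' by (intro base) (use a in auto)
    then show False using gap[of t a b] t assms by auto
  qed
  have "\<not> b < d'"
  proof
    assume "b < d'"
    then have "b < min d' (a + L)" using assms by auto
    then obtain t where t: "b < t" "t < min d' (a + L)" using dense by blast
    then have "t \<in> ?A" unfolding eq' by (intro base) (use ac assms in auto)
    then show False using gap'[of t a b] t assms by auto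
  qed
  moreover have "\<not> d' < b"
  proof
    assume "d' < b"
    then have "d' < min b (c' + L)" using len by auto
    then obtain t where t: "d' < t" "t < min b (c' + L)" using dense by blast
    then have "t \<in> ?C'" unfolding eq'[symmetric] by (intro base) (use a in auto)
    then show False using gap'[of t c' d'] t a ac by auto
  qed
  ultimately have "b = d'" by simp
  then show ?thesis using ac by (intro exI[of _ "- m"]) (auto simp: c'_def d'_def)
qed

text \<open>Reduces periodic boxes to periodic intervals. A nonempty box has a point over every
  value in its side, and the lattice contains periods in a single coordinate direction.\<close>

lemma inner_image_on_torus_cbox:
  fixes p q l c :: "'a::euclidean_space"
  assumes c: "c \<in> Basis" and pq: "\<forall>b\<in>Basis. p \<bullet> b \<le> q \<bullet> b"
  shows "(\<lambda>x. x \<bullet> c) ` on_torus l (cbox p q) =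
         {t + of_int m * (l \<bullet> c) |t m. p \<bullet> c \<le> t \<and> t \<le> q \<bullet> c}" (is "?A = ?B")
proof
  show "?A \<subseteq> ?B"
  proof
    fix y assume "y \<in> ?A"
    then obtain x k where x: "y = (x + k) \<bullet> c" "x \<in> cbox p q" "k \<in> periods l"
      unfolding on_torus_def by auto
    obtain m :: int where "k \<bullet> c = of_int m * (l \<bullet> c)" using x c unfolding periods_def by auto
    then show "y \<in> ?B" using x c by (auto simp: mem_box inner_add_left)
  qed
  show "?B \<subseteq> ?A"
  proof
    fix y assume "y \<in> ?B"
    then obtain t m where t: "y = t + of_int m * (l \<bullet> c)" "p \<bullet> c \<le> t" "t \<le> q \<bullet> c" by auto
    \<comment> \<open>The corner \<open>p\<close> with only its coordinate in direction
      \<open>c\<close> changed to \<open>t\<close>; \<open>k\<close> likewise moves in direction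
      \<open>c\<close> only.\<close>
    define x where "x = p + (t - p \<bullet> c) *\<^sub>R c"
    define k where "k = (of_int m * (l \<bullet> c)) *\<^sub>R c"
    have "x \<in> cbox p q" using t c pq
      by (auto simp: x_def mem_box inner_add_left inner_Basis)
    moreover have "k \<in> periods l" unfolding periods_def
    proof (intro CollectI ballI)
      fix b :: 'a assume "b \<in> Basis"
      then show "\<exists>n::int. k \<bullet> b = of_int n * (l \<bullet> b)" using c
        by (cases "b = c") (auto simp: k_def inner_Basis intro: exI[of _ m] exI[of _ "0::int"])
    qed
    moreover have "y = (x + k) \<bullet> c" using c t by (simp add: x_def k_def inner_add_left inner_Basis)
    ultimately show "y \<in> ?A" unfolding on_torus_def by blast
  qed
qed

text \<open>The interval result gives one integer per direction; since the lattice is a product,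
  these integers assemble into a single period.\<close>

lemma on_torus_cbox_eqD:
  fixes p q p' q' l :: "'a::euclidean_space"
  assumes pq: "\<forall>b\<in>Basis. p \<bullet> b \<le> q \<bullet> b \<and> q \<bullet> b - p \<bullet> b < l \<bullet> b"
    and pq': "\<forall>b\<in>Basis. p' \<bullet> b \<le> q' \<bullet> b \<and> q' \<bullet> b - p' \<bullet> b < l \<bullet> b"
    and eq: "on_torus l (cbox p q) = on_torus l (cbox p' q')"
  shows "\<exists>k\<in>periods l. p' = p + k \<and> q' = q + k"
proof (rule bexI[of _ "p' - p"])
  have *: "\<exists>m::int. p' \<bullet> b = p \<bullet> b + of_int m * (l \<bullet> b) \<and> q' \<bullet> b = q \<bullet> b + of_int m * (l \<bullet> b)"
    if b: "b \<in> Basis" for b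
  proof (rule periodic_interval_shift)
    show "{t + of_int m * (l \<bullet> b) |t m. p \<bullet> b \<le> t \<and> t \<le> q \<bullet> b} =
          {t + of_int m * (l \<bullet> b) |t m. p' \<bullet> b \<le> t \<and> t \<le> q' \<bullet> b}"
      using inner_image_on_torus_cbox[OF b, of p q l] inner_image_on_torus_cbox[OF b, of p' q' l]
        pq pq' eq by simp
  qed (use pq pq' b in auto)
  show "p' - p \<in> periods l" unfolding periods_def using * by (fastforce simp: inner_diff_left)
  have "q' = q + (p' - p)"
    by (rule euclidean_eqI) (use * in \<open>fastforce simp: inner_diff_left inner_add_left\<close>)
  then show "p' = p + (p' - p) \<and> q' = q + (p' - p)" by simp
qed

section \<open>Faces of a box as degenerate boxes, and their measure\<close>

text \<open>The maximum of \<open>x \<bullet> b\<close> over the box is attained at the corner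
  \<open>q\<close>, so the face is the slice at that height; raising \<open>p\<close> to it makes
  the slice a box again.\<close>

lemma face_cbox_Basis:
  assumes b: "b \<in> Basis" and pq: "\<forall>c\<in>Basis. p \<bullet> c \<le> q \<bullet> c"
  shows "face (cbox p q) b = cbox (p + ((q - p) \<bullet> b) *\<^sub>R b) q"
proof -
  have "q \<in> cbox p q" using pq by (auto simp: mem_box)
  then have "face (cbox p q) b = {x \<in> cbox p q. x \<bullet> b = q \<bullet> b}"
    using b unfolding face_def by (fastforce simp: mem_box)
  also have "\<dots> = cbox (p + ((q - p) \<bullet> b) *\<^sub>R b) q"
  proof (intro set_eqI iffI)
    fix x assume x: "x \<in> {x \<in> cbox p q. x \<bullet> b = q \<bullet> b}"
    show "x \<in> cbox (p + ((q - p) \<bullet> b) *\<^sub>R b) q" unfolding mem_box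
    proof
      fix c :: 'a assume "c \<in> Basis"
      then show "(p + ((q - p) \<bullet> b) *\<^sub>R b) \<bullet> c \<le> x \<bullet> c \<and> x \<bullet> c \<le> q \<bullet> c"
        using x b by (cases "c = b")
          (auto simp: mem_box inner_add_left inner_diff_left inner_Basis)
    qed
  next
    fix x assume "x \<in> cbox (p + ((q - p) \<bullet> b) *\<^sub>R b) q"
    then have x: "(p + ((q - p) \<bullet> b) *\<^sub>R b) \<bullet> c \<le> x \<bullet> c \<and> x \<bullet> c \<le> q \<bullet> c" if "c \<in> Basis" for c
      using that by (simp add: mem_box)
    have "p \<bullet> c \<le> x \<bullet> c \<and> x \<bullet> c \<le> q \<bullet> c" if "c \<in> Basis" for c
      using x[OF that] pq b that by (cases "c = b")
        (auto simp: inner_add_left inner_diff_left inner_Basis)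
    moreover have "x \<bullet> b = q \<bullet> b"
      using x[OF b] b by (simp add: inner_add_left inner_diff_left inner_Basis)
    ultimately show "x \<in> {x \<in> cbox p q. x \<bullet> b = q \<bullet> b}" by (simp add: mem_box)
  qed
  finally show ?thesis .
qed

lemma face_cbox_uminus_Basis:
  assumes b: "b \<in> Basis" and pq: "\<forall>c\<in>Basis. p \<bullet> c \<le> q \<bullet> c"
  shows "face (cbox p q) (- b) = cbox p (q - ((q - p) \<bullet> b) *\<^sub>R b)"
proof -
  have "p \<in> cbox p q" using pq by (auto simp: mem_box)
  then have "face (cbox p q) (- b) = {x \<in> cbox p q. x \<bullet> b = p \<bullet> b}"
    using b unfolding face_def by (fastforce simp: mem_box)
  also have "\<dots> = cbox p (q - ((q - p) \<bullet> b) *\<^sub>R b)"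
  proof (intro set_eqI iffI)
    fix x assume x: "x \<in> {x \<in> cbox p q. x \<bullet> b = p \<bullet> b}"
    show "x \<in> cbox p (q - ((q - p) \<bullet> b) *\<^sub>R b)" unfolding mem_box
    proof
      fix c :: 'a assume "c \<in> Basis"
      then show "p \<bullet> c \<le> x \<bullet> c \<and> x \<bullet> c \<le> (q - ((q - p) \<bullet> b) *\<^sub>R b) \<bullet> c"
        using x b by (cases "c = b")
          (auto simp: mem_box inner_diff_left inner_Basis)
    qed
  next
    fix x assume "x \<in> cbox p (q - ((q - p) \<bullet> b) *\<^sub>R b)"
    then have x: "p \<bullet> c \<le> x \<bullet> c \<and> x \<bullet> c \<le> (q - ((q - p) \<bullet> b) *\<^sub>R b) \<bullet> c" if "c \<in> Basis" for c
      using that by (simp add: mem_box)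
    have "p \<bullet> c \<le> x \<bullet> c \<and> x \<bullet> c \<le> q \<bullet> c" if "c \<in> Basis" for c
      using x[OF that] pq b that by (cases "c = b")
        (auto simp: inner_diff_left inner_Basis)
    moreover have "x \<bullet> b = p \<bullet> b"
      using x[OF b] b by (simp add: inner_diff_left inner_Basis)
    ultimately show "x \<in> {x \<in> cbox p q. x \<bullet> b = p \<bullet> b}" by (simp add: mem_box)
  qed
  finally show ?thesis .
qed

text \<open>Common form of the two preceding results: the face is flat in the direction of its
  normal and keeps the full side in every other direction.\<close>

lemma face_cbox:
  fixes u :: "'a::euclidean_space"
  assumes "u \<in> axis_dirs" "\<forall>b\<in>Basis. p \<bullet> b < q \<bullet> b \<and> q \<bullet> b - p \<bullet> b < l \<bullet> b"
  obtains b p1 q1 where "b \<in> Basis" "u = b \<or> u = - b" "face (cbox p q) u = cbox p1 q1"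
    "\<forall>c\<in>Basis. p1 \<bullet> c \<le> q1 \<bullet> c \<and> q1 \<bullet> c - p1 \<bullet> c < l \<bullet> c"
    "\<forall>c\<in>Basis. c \<noteq> b \<longrightarrow> p1 \<bullet> c = p \<bullet> c \<and> q1 \<bullet> c = q \<bullet> c"
    "u = b \<longrightarrow> p1 \<bullet> b = q \<bullet> b \<and> q1 \<bullet> b = q \<bullet> b"
    "u = - b \<longrightarrow> p1 \<bullet> b = p \<bullet> b \<and> q1 \<bullet> b = p \<bullet> b"
proof -
  have le: "\<forall>c\<in>Basis. p \<bullet> c \<le> q \<bullet> c" and pos: "\<forall>c\<in>Basis. 0 < l \<bullet> c"
    using assms(2) by force+
  \<comment> \<open>Keeps the cases \<open>u = b\<close> and \<open>u = - b\<close> exclusive, so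
    that only one of the two implications about the height has content.\<close>
  have ne: "b \<noteq> - b" if "b \<in> Basis" for b :: 'a
    using nonzero_Basis[OF that] by (metis one_neq_neg_one scaleR_cancel_right scaleR_minus1_left scaleR_one)
  consider b where "b \<in> Basis" "u = b" | b where "b \<in> Basis" "u = - b"
    using assms(1) unfolding axis_dirs_def by auto
  then show thesis
  proof cases
    case 1
    show thesis
      by (rule that[of b "p + ((q - p) \<bullet> b) *\<^sub>R b" q])
        (use 1 ne[OF 1(1)] le pos assms(2) face_cbox_Basis[OF 1(1) le] in
          \<open>auto simp: inner_add_left inner_diff_left inner_Basis\<close>)
  next
    case 2
    show thesis
      by (rule that[of b p "q - ((q - p) \<bullet> b) *\<^sub>R b"])
        (use 2 ne[OF 2(1)] le pos assms(2) face_cbox_uminus_Basis[OF 2(1) le] in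
          \<open>auto simp: inner_diff_left inner_Basis\<close>)
  qed
qed

text \<open>Forgetting the coordinate along the normal turns the box into a product of intervals,
  whose product measure is the product of the lengths.\<close>

lemma hyperplane_measure_cbox:
  fixes p q u :: "'a::euclidean_space"
  assumes pq: "\<forall>b\<in>Basis. p \<bullet> b \<le> q \<bullet> b"
  shows "hyperplane_measure u (cbox p q) = (\<Prod>b\<in>{b\<in>Basis. b \<bullet> u = 0}. q \<bullet> b - p \<bullet> b)"
proof -
  define B where "B = {b\<in>Basis. b \<bullet> u = 0}"
  have B: "finite B" "B \<subseteq> Basis" by (auto simp: B_def)
  interpret product_sigma_finite "\<lambda>b::'a. lborel :: real measure" by standard
  have img: "(\<lambda>x. \<lambda>b\<in>B. x \<bullet> b) ` cbox p q = (\<Pi>\<^sub>E b\<in>B. {p \<bullet> b..q \<bullet> b})" (is "?A = ?C")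
  proof
    show "?A \<subseteq> ?C" using B by (auto simp: mem_box)
    show "?C \<subseteq> ?A"
    proof
      fix f assume f: "f \<in> ?C"
      \<comment> \<open>A preimage of \<open>f\<close> in the box: the forgotten coordinates are
        filled in from \<open>p\<close>.\<close>
      define x where "x = (\<Sum>b\<in>Basis. (if b \<in> B then f b else p \<bullet> b) *\<^sub>R b)"
      have x: "x \<bullet> b = (if b \<in> B then f b else p \<bullet> b)" if "b \<in> Basis" for b
        unfolding x_def by (rule inner_sum_left_Basis[OF that])
      have "x \<in> cbox p q" unfolding mem_box using f pq by (auto simp: x PiE_def Pi_def)
      moreover have "f = (\<lambda>b\<in>B. x \<bullet> b)"
      proof
        fix b show "f b = (\<lambda>b\<in>B. x \<bullet> b) b"
          using f B x[of b] by (cases "b \<in> B") (auto simp: PiE_def extensional_def)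
      qed
      ultimately show "f \<in> ?A" by blast
    qed
  qed
  have "emeasure (\<Pi>\<^sub>M b\<in>B. (lborel :: real measure)) ?C = (\<Prod>b\<in>B. emeasure lborel {p \<bullet> b..q \<bullet> b})"
    by (rule emeasure_PiM) (use B in auto)
  also have "\<dots> = (\<Prod>b\<in>B. ennreal (q \<bullet> b - p \<bullet> b))"
    by (rule prod.cong) (use pq B in auto)
  also have "\<dots> = ennreal (\<Prod>b\<in>B. q \<bullet> b - p \<bullet> b)"
    by (rule prod_ennreal) (use pq B in auto)
  finally have "measure (\<Pi>\<^sub>M b\<in>B. (lborel :: real measure)) ?C = (\<Prod>b\<in>B. q \<bullet> b - p \<bullet> b)"
    using pq B by (simp add: measure_def subset_iff prod_nonneg)
  then show ?thesis unfolding hyperplane_measure_def Let_def B_def[symmetric] img .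
qed

lemma box_shift_subset_interior_on_torus:
  assumes "k \<in> periods l"
  shows "box (p + k) (q + k) \<subseteq> interior (on_torus l (cbox p q))"
proof (rule interior_maximal)
  show "box (p + k) (q + k) \<subseteq> on_torus l (cbox p q)"
  proof
    fix x assume "x \<in> box (p + k) (q + k)"
    then have "x - k \<in> cbox p q" by (force simp: mem_box inner_diff_left inner_add_left)
    then show "x \<in> on_torus l (cbox p q)"
      unfolding on_torus_def using assms by (intro CollectI exI[of _ "x - k"] exI[of _ k]) auto
  qed
qed (rule open_box)

section \<open>Two boxes with a common face on the torus\<close>

context
  fixes p q p' q' u u' l :: "'a::euclidean_space"
  assumes pq: "\<forall>b\<in>Basis. p \<bullet> b < q \<bullet> b \<and> q \<bullet> b - p \<bullet> b < l \<bullet> b"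
    and pq': "\<forall>b\<in>Basis. p' \<bullet> b < q' \<bullet> b \<and> q' \<bullet> b - p' \<bullet> b < l \<bullet> b"
    and u: "u \<in> axis_dirs" and u': "u' \<in> axis_dirs"
    and eq: "on_torus l (face (cbox p q) u) = on_torus l (face (cbox p' q') u')"
begin

text \<open>The two lifts of the common face differ by a period \<open>k\<close>. A face is flat
  only along its normal, so the normals agree up to sign, and translation by \<open>k\<close>
  preserves the side lengths and hence the measure.\<close>

lemma shared_face:
  obtains b k where "b \<in> Basis" "k \<in> periods l" "u = b \<or> u = - b" "u' = b \<or> u' = - b"
    "\<forall>c\<in>Basis. c \<noteq> b \<longrightarrow> p' \<bullet> c = p \<bullet> c + k \<bullet> c \<and> q' \<bullet> c = q \<bullet> c + k \<bullet> c"
    "(if u' = b then q' else p') \<bullet> b = (if u = b then q else p) \<bullet> b + k \<bullet> b"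
    "hyperplane_measure u (face (cbox p q) u) = hyperplane_measure u' (face (cbox p' q') u')"
proof -
  obtain b p1 q1 where 1: "b \<in> Basis" "u = b \<or> u = - b" "face (cbox p q) u = cbox p1 q1"
    "\<forall>c\<in>Basis. p1 \<bullet> c \<le> q1 \<bullet> c \<and> q1 \<bullet> c - p1 \<bullet> c < l \<bullet> c"
    "\<forall>c\<in>Basis. c \<noteq> b \<longrightarrow> p1 \<bullet> c = p \<bullet> c \<and> q1 \<bullet> c = q \<bullet> c"
    "u = b \<longrightarrow> p1 \<bullet> b = q \<bullet> b \<and> q1 \<bullet> b = q \<bullet> b"
    "u = - b \<longrightarrow> p1 \<bullet> b = p \<bullet> b \<and> q1 \<bullet> b = p \<bullet> b"
    by (rule face_cbox[OF u pq])
  obtain b' p2 q2 where 2: "b' \<in> Basis" "u' = b' \<or> u' = - b'" "face (cbox p' q') u' = cbox p2 q2"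
    "\<forall>c\<in>Basis. p2 \<bullet> c \<le> q2 \<bullet> c \<and> q2 \<bullet> c - p2 \<bullet> c < l \<bullet> c"
    "\<forall>c\<in>Basis. c \<noteq> b' \<longrightarrow> p2 \<bullet> c = p' \<bullet> c \<and> q2 \<bullet> c = q' \<bullet> c"
    "u' = b' \<longrightarrow> p2 \<bullet> b' = q' \<bullet> b' \<and> q2 \<bullet> b' = q' \<bullet> b'"
    "u' = - b' \<longrightarrow> p2 \<bullet> b' = p' \<bullet> b' \<and> q2 \<bullet> b' = p' \<bullet> b'"
    by (rule face_cbox[OF u' pq'])
  obtain k where k: "k \<in> periods l" "p2 = p1 + k" "q2 = q1 + k"
    using on_torus_cbox_eqD[OF 1(4) 2(4)] eq 1(3) 2(3) by auto
  \<comment> \<open>Otherwise the second face would have the full positive side in direction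
    \<open>b\<close>, where the first one is flat.\<close>
  have b: "b' = b"
  proof (rule ccontr)
    assume "b' \<noteq> b"
    then have "p2 \<bullet> b = p' \<bullet> b" "q2 \<bullet> b = q' \<bullet> b" using 1(1) 2(5) by auto
    moreover have "p1 \<bullet> b = q1 \<bullet> b" using 1 by auto
    ultimately show False using k pq' 1(1) by (auto simp: inner_add_left)
  qed
  show thesis
  proof (rule that[of b k])
    have "hyperplane_measure u (cbox p1 q1) = hyperplane_measure u' (cbox p2 q2)"
      using hyperplane_measure_cbox[of p1 q1 u] hyperplane_measure_cbox[of p2 q2 u'] 1(2,4) 2(2,4) k b
      by (auto simp: inner_add_left)
    then show "hyperplane_measure u (face (cbox p q) u) = hyperplane_measure u' (face (cbox p' q') u')"
      using 1 2 by simp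
    show "(if u' = b then q' else p') \<bullet> b = (if u = b then q else p) \<bullet> b + k \<bullet> b"
      using 1(2,6,7) 2(2,6,7) b k by (auto simp: inner_add_left)
    show "\<forall>c\<in>Basis. c \<noteq> b \<longrightarrow> p' \<bullet> c = p \<bullet> c + k \<bullet> c \<and> q' \<bullet> c = q \<bullet> c + k \<bullet> c"
      using 1(5) 2(5) b k by (auto simp: inner_add_left)
  qed (use 1 2 k b in auto)
qed

text \<open>With equal normals, after the shift by \<open>k\<close> both boxes lie on the same side
  of the common face and have the same cross-section.\<close>

lemma shared_face_overlap:
  assumes "u' = u"
  shows "interior (on_torus l (cbox p q)) \<inter> interior (on_torus l (cbox p' q')) \<noteq> {}"
proof -
  obtain b k where bk: "b \<in> Basis" "k \<in> periods l"
    "\<forall>c\<in>Basis. c \<noteq> b \<longrightarrow> p' \<bullet> c = p \<bullet> c + k \<bullet> c \<and> q' \<bullet> c = q \<bullet> c + k \<bullet> c"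
    "(if u' = b then q' else p') \<bullet> b = (if u = b then q else p) \<bullet> b + k \<bullet> b"
    by (rule shared_face)
  \<comment> \<open>Exactly the conditions for the intersection of the two open boxes to be
    nonempty: every lower corner lies below every upper corner.\<close>
  have *: "(p + k) \<bullet> c < q' \<bullet> c \<and> p' \<bullet> c < (q + k) \<bullet> c \<and> (p + k) \<bullet> c < (q + k) \<bullet> c \<and> p' \<bullet> c < q' \<bullet> c"
    if "c \<in> Basis" for c
    using bk(3)[rule_format, OF that] bk(4) pq[rule_format, OF that] pq'[rule_format, OF that] assms
    by (cases "c = b") (auto simp: inner_add_left split: if_splits)
  have "0 \<in> periods l" by (auto simp: periods_def intro: exI[of _ "0::int"])
  then have "box (p + k) (q + k) \<inter> box p' q' \<subseteq>
      interior (on_torus l (cbox p q)) \<inter> interior (on_torus l (cbox p' q'))"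
    using box_shift_subset_interior_on_torus[OF bk(2), of p q]
      box_shift_subset_interior_on_torus[of 0 l p' q'] by auto
  moreover have "box (p + k) (q + k) \<inter> box p' q' \<noteq> {}"
    unfolding box_Int_box box_ne_empty using * by simp
  ultimately show ?thesis by blast
qed

text \<open>Two opposite faces of one box are a side length apart, which lies strictly between zero
  and the period and so is no multiple of the period.\<close>

lemma shared_face_same_cell:
  assumes "p' = p" "q' = q"
  shows "u' = u"
proof (rule ccontr)
  assume ne: "u' \<noteq> u"
  obtain b k where bk: "b \<in> Basis" "k \<in> periods l" "u = b \<or> u = - b" "u' = b \<or> u' = - b"
    "\<forall>c\<in>Basis. c \<noteq> b \<longrightarrow> p' \<bullet> c = p \<bullet> c + k \<bullet> c \<and> q' \<bullet> c = q \<bullet> c + k \<bullet> c"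
    "(if u' = b then q' else p') \<bullet> b = (if u = b then q else p) \<bullet> b + k \<bullet> b"
    by (rule shared_face)
  obtain m :: int where m: "k \<bullet> b = of_int m * (l \<bullet> b)" using bk unfolding periods_def by auto
  have s: "0 < q \<bullet> b - p \<bullet> b" "q \<bullet> b - p \<bullet> b < l \<bullet> b" using pq bk(1) by auto
  \<comment> \<open>The sign depends on which of the two opposite faces is the one with normal
    \<open>u\<close>.\<close>
  have "of_int m * (l \<bullet> b) = q \<bullet> b - p \<bullet> b \<or> of_int m * (l \<bullet> b) = - (q \<bullet> b - p \<bullet> b)"
  proof (cases "u = b")
    case True
    then show ?thesis using bk(6) ne assms m by simp
  next
    case False
    then have "u' = b" using bk(3,4) ne by auto
    then show ?thesis using bk(6) False assms m by simp
  qed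
  then have "\<bar>of_int m * (l \<bullet> b)\<bar> = q \<bullet> b - p \<bullet> b" using s by linarith
  then have "\<bar>real_of_int m\<bar> * (l \<bullet> b) = q \<bullet> b - p \<bullet> b" using s by (simp add: abs_mult)
  then have "0 < \<bar>real_of_int m\<bar> * (l \<bullet> b)" "\<bar>real_of_int m\<bar> * (l \<bullet> b) < 1 * (l \<bullet> b)" using s by auto
  then have "0 < \<bar>real_of_int m\<bar>" "\<bar>real_of_int m\<bar> < 1"
    using s by (simp_all only: zero_less_mult_iff mult_less_cancel_right) linarith+
  then have "0 < \<bar>m\<bar>" "\<bar>m\<bar> < 1" by (simp_all flip: of_int_abs)
  then show False by linarith
qed

end

section \<open>Edges of a periodic mesh\<close>

lemma finite_edges: "finite (edges l K)"
proof -
  have "edges l K = (\<lambda>u. on_torus l (face K u)) ` axis_dirs" unfolding edges_def by auto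
  then show ?thesis by (simp add: axis_dirs_def)
qed

lemma edge_measure_nonneg: "0 \<le> edge_measure l K \<sigma>"
  unfolding edge_measure_def hyperplane_measure_def Let_def by simp

text \<open>Cauchy-Schwarz after splitting each weight into two square roots, one for each
  factor.\<close>

lemma norm_weighted_sum_squared_le:
  fixes x :: "'i \<Rightarrow> 'b::real_normed_vector"
  assumes "\<And>i. i \<in> I \<Longrightarrow> 0 \<le> a i"
  shows "(norm (\<Sum>i\<in>I. a i *\<^sub>R x i))\<^sup>2 \<le> (\<Sum>i\<in>I. a i) * (\<Sum>i\<in>I. a i * (norm (x i))\<^sup>2)"
proof -
  have "norm (\<Sum>i\<in>I. a i *\<^sub>R x i) \<le> (\<Sum>i\<in>I. sqrt (a i) * (sqrt (a i) * norm (x i)))"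
    by (rule order_trans[OF norm_sum]) (simp add: assms flip: mult.assoc)
  then have "(norm (\<Sum>i\<in>I. a i *\<^sub>R x i))\<^sup>2 \<le> (\<Sum>i\<in>I. sqrt (a i) * (sqrt (a i) * norm (x i)))\<^sup>2"
    by (rule power_mono) simp
  also have "\<dots> \<le> (\<Sum>i\<in>I. (sqrt (a i))\<^sup>2) * (\<Sum>i\<in>I. (sqrt (a i) * norm (x i))\<^sup>2)"
    by (rule Cauchy_Schwarz_ineq_sum)
  also have "\<dots> = (\<Sum>i\<in>I. a i) * (\<Sum>i\<in>I. a i * (norm (x i))\<^sup>2)"
    using assms by (simp add: power_mult_distrib)
  finally show ?thesis .
qed

text \<open>The local dissipation \<open>D\<^sub>K\<close> of the upwind scheme. The weight is minus
  \<open>wm\<close>, which is nonnegative when \<open>wm\<close> is the nonpositive part of a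
  flux.\<close>

definition jump_energy ::
  "'a::euclidean_space \<Rightarrow> 'a set set \<Rightarrow> ('a set \<Rightarrow> 'a) \<Rightarrow> ('a set \<Rightarrow> 'a set \<Rightarrow> real) \<Rightarrow> 'a set \<Rightarrow> real"
  where
  "jump_energy l \<T> V wm K = (\<Sum>\<sigma>\<in>edges l K.
     (edge_measure l K \<sigma> * - wm K \<sigma>) * (norm (V (neighbour l \<T> K \<sigma>) - V K))\<^sup>2)"

section \<open>Cells, normals and neighbours in a fixed mesh\<close>

context
  fixes l :: "'a::euclidean_space" and \<T> :: "'a set set"
  assumes mesh: "periodic_mesh l \<T>"
begin

lemma mesh_cell:
  assumes "K \<in> \<T>"
  obtains p q where "K = cbox p q" "\<forall>b\<in>Basis. p \<bullet> b < q \<bullet> b \<and> q \<bullet> b - p \<bullet> b < l \<bullet> b"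
proof -
  show thesis
    using mesh[unfolded periodic_mesh_def, THEN conjunct2, THEN conjunct2,
        THEN conjunct1, rule_format, OF assms] that by (elim exE conjE)
qed

lemma finite_mesh: "finite \<T>"
  using mesh unfolding periodic_mesh_def by (elim conjE)

lemma measure_mesh_cell_pos:
  assumes "K \<in> \<T>"
  shows "0 < measure lebesgue K"
proof -
  obtain p q where "K = cbox p q" "\<forall>b\<in>Basis. p \<bullet> b < q \<bullet> b \<and> q \<bullet> b - p \<bullet> b < l \<bullet> b"
    by (rule mesh_cell[OF assms])
  then show ?thesis by (auto simp: content_pos_lt)
qed

text \<open>Justifies the definite description in \<open>normal\<close>: a box with sides shorter
  than the periods has distinct faces on the torus.\<close>

lemma normal_eqI:
  assumes "K \<in> \<T>" "u \<in> axis_dirs" "\<sigma> = on_torus l (face K u)"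
  shows "normal l K \<sigma> = u"
  unfolding normal_def
proof (rule the_equality)
  fix u' assume "u' \<in> axis_dirs \<and> \<sigma> = on_torus l (face K u')"
  moreover obtain p q where "K = cbox p q" "\<forall>b\<in>Basis. p \<bullet> b < q \<bullet> b \<and> q \<bullet> b - p \<bullet> b < l \<bullet> b"
    by (rule mesh_cell[OF assms(1)])
  ultimately show "u' = u"
    using shared_face_same_cell[of p q l p q u u'] assms by blast
qed (use assms in simp)

lemma normal_axis:
  assumes "K \<in> \<T>" "\<sigma> \<in> edges l K"
  shows "normal l K \<sigma> \<in> axis_dirs" "\<sigma> = on_torus l (face K (normal l K \<sigma>))"
proof -
  obtain u where u: "u \<in> axis_dirs" "\<sigma> = on_torus l (face K u)"
    using assms(2) unfolding edges_def by blast
  then have "normal l K \<sigma> = u" by (rule normal_eqI[OF assms(1)])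
  then show "normal l K \<sigma> \<in> axis_dirs" "\<sigma> = on_torus l (face K (normal l K \<sigma>))"
    using u by simp_all
qed

lemma norm_normal:
  assumes "K \<in> \<T>" "\<sigma> \<in> edges l K"
  shows "norm (normal l K \<sigma>) = 1"
  using normal_axis(1)[OF assms] unfolding axis_dirs_def by auto

text \<open>Normals at a common edge agree up to sign, and equal normals would make the cells
  overlap, against the disjointness of interiors.\<close>

lemma shared_edge:
  assumes K: "K \<in> \<T>" "\<sigma> \<in> edges l K" and L: "L \<in> \<T>" "\<sigma> \<in> edges l L" and ne: "K \<noteq> L"
  shows "normal l L \<sigma> = - normal l K \<sigma>" "edge_measure l L \<sigma> = edge_measure l K \<sigma>"
proof -
  obtain p q where pq: "K = cbox p q" "\<forall>b\<in>Basis. p \<bullet> b < q \<bullet> b \<and> q \<bullet> b - p \<bullet> b < l \<bullet> b"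
    by (rule mesh_cell[OF K(1)])
  obtain p' q' where pq': "L = cbox p' q'" "\<forall>b\<in>Basis. p' \<bullet> b < q' \<bullet> b \<and> q' \<bullet> b - p' \<bullet> b < l \<bullet> b"
    by (rule mesh_cell[OF L(1)])
  have eq: "on_torus l (face (cbox p q) (normal l K \<sigma>)) = on_torus l (face (cbox p' q') (normal l L \<sigma>))"
    using normal_axis(2)[OF K] normal_axis(2)[OF L] unfolding pq(1) pq'(1) by (rule trans[OF sym])
  note sf = pq(2) pq'(2) normal_axis(1)[OF K] normal_axis(1)[OF L] eq
  have "interior (on_torus l K) \<inter> interior (on_torus l L) = {}"
    by (rule mesh[unfolded periodic_mesh_def, THEN conjunct2, THEN conjunct2, THEN conjunct2, THEN conjunct2,
        THEN conjunct1, rule_format, OF K(1) L(1) ne])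
  then have "normal l L \<sigma> \<noteq> normal l K \<sigma>"
    using shared_face_overlap[OF sf] pq(1) pq'(1) by blast
  moreover obtain b where b: "normal l K \<sigma> = b \<or> normal l K \<sigma> = - b"
    "normal l L \<sigma> = b \<or> normal l L \<sigma> = - b"
    and meas: "hyperplane_measure (normal l K \<sigma>) (face (cbox p q) (normal l K \<sigma>)) =
      hyperplane_measure (normal l L \<sigma>) (face (cbox p' q') (normal l L \<sigma>))"
    by (rule shared_face[OF sf])
  ultimately show "normal l L \<sigma> = - normal l K \<sigma>" by (metis minus_minus)
  show "edge_measure l L \<sigma> = edge_measure l K \<sigma>"
    using meas unfolding edge_measure_def pq(1)[symmetric] pq'(1)[symmetric] by (rule sym)
qed

text \<open>A third cell at the same edge is impossible: three normals would be pairwise opposite,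
  which forces a unit vector to equal its own negative.\<close>

lemma neighbour_eqI:
  assumes K: "K \<in> \<T>" "\<sigma> \<in> edges l K" and L: "L \<in> \<T>" "\<sigma> \<in> edges l L" and ne: "K \<noteq> L"
  shows "neighbour l \<T> K \<sigma> = L"
  unfolding neighbour_def
proof (rule the_equality)
  fix M assume M: "M \<in> \<T> \<and> M \<noteq> K \<and> \<sigma> \<in> edges l M"
  show "M = L"
  proof (rule ccontr)
    assume "M \<noteq> L"
    then have "normal l M \<sigma> = - normal l L \<sigma>" using shared_edge(1)[OF L] M by auto
    moreover have "normal l L \<sigma> = - normal l K \<sigma>" "normal l M \<sigma> = - normal l K \<sigma>"
      using shared_edge(1)[OF K] L ne M by auto
    ultimately have "normal l K \<sigma> = - normal l K \<sigma>" by simp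
    then have "normal l K \<sigma> = 0"
      by (metis add.right_inverse scaleR_2 scaleR_eq_0_iff zero_neq_numeral)
    then show False using norm_normal[OF K] by simp
  qed
qed (use assms in simp)

text \<open>Makes passing to the other side of an edge an involution on pairs of a cell and one of
  its edges; it reverses the normal and keeps the measure.\<close>

lemma neighbour:
  assumes "K \<in> \<T>" "\<sigma> \<in> edges l K"
  shows "neighbour l \<T> K \<sigma> \<in> \<T>" "neighbour l \<T> K \<sigma> \<noteq> K" "\<sigma> \<in> edges l (neighbour l \<T> K \<sigma>)"
    "neighbour l \<T> (neighbour l \<T> K \<sigma>) \<sigma> = K"
    "normal l (neighbour l \<T> K \<sigma>) \<sigma> = - normal l K \<sigma>"
    "edge_measure l (neighbour l \<T> K \<sigma>) \<sigma> = edge_measure l K \<sigma>"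
proof -
  obtain L where L: "L \<in> \<T>" "L \<noteq> K" "\<sigma> \<in> edges l L"
    using mesh[unfolded periodic_mesh_def, THEN conjunct2, THEN conjunct2, THEN conjunct2,
        THEN conjunct2, THEN conjunct2, THEN conjunct2,
        rule_format, OF assms] by blast
  have n: "neighbour l \<T> K \<sigma> = L" using neighbour_eqI assms L by metis
  show "neighbour l \<T> K \<sigma> \<in> \<T>" "neighbour l \<T> K \<sigma> \<noteq> K" "\<sigma> \<in> edges l (neighbour l \<T> K \<sigma>)"
    using L n by auto
  show "neighbour l \<T> (neighbour l \<T> K \<sigma>) \<sigma> = K" unfolding n
    using neighbour_eqI[OF L(1,3) assms L(2)] .
  show "normal l (neighbour l \<T> K \<sigma>) \<sigma> = - normal l K \<sigma>"
    "edge_measure l (neighbour l \<T> K \<sigma>) \<sigma> = edge_measure l K \<sigma>"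
    unfolding n using shared_edge[OF assms L(1,3)] L(2) by auto
qed

section \<open>Discrete integration by parts\<close>

text \<open>Reindexing by the involution that swaps the two sides of each edge shows that the sum
  equals its own negative; no orientation of the edges has to be chosen.\<close>

lemma sum_edges_antisym:
  fixes f :: "'a set \<Rightarrow> 'a set \<Rightarrow> real"
  assumes "\<And>K \<sigma>. K \<in> \<T> \<Longrightarrow> \<sigma> \<in> edges l K \<Longrightarrow> f (neighbour l \<T> K \<sigma>) \<sigma> = - f K \<sigma>"
  shows "(\<Sum>K\<in>\<T>. \<Sum>\<sigma>\<in>edges l K. f K \<sigma>) = 0"
proof -
  let ?S = "Sigma \<T> (edges l)" and ?g = "\<lambda>(K, \<sigma>). (neighbour l \<T> K \<sigma>, \<sigma>)"
  have "(\<Sum>K\<in>\<T>. \<Sum>\<sigma>\<in>edges l K. f K \<sigma>) = (\<Sum>(K, \<sigma>)\<in>?S. f K \<sigma>)"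
    using finite_mesh finite_edges by (intro sum.Sigma) auto
  moreover have "(\<Sum>(K, \<sigma>)\<in>?S. f K \<sigma>) = (\<Sum>(K, \<sigma>)\<in>?S. - f K \<sigma>)"
    by (rule sum.reindex_bij_witness[of _ ?g ?g]) (auto simp: neighbour assms)
  moreover have "(\<Sum>(K, \<sigma>)\<in>?S. - f K \<sigma>) = - (\<Sum>(K, \<sigma>)\<in>?S. f K \<sigma>)"
    by (simp add: split_def sum_negf)
  ultimately show ?thesis by linarith
qed

lemma flux_neighbour:
  assumes "K \<in> \<T>" "\<sigma> \<in> edges l K"
  shows "flux l \<T> w (neighbour l \<T> K \<sigma>) \<sigma> = - flux l \<T> w K \<sigma>"
  unfolding flux_def using neighbour[OF assms] by (simp add: add.commute)

text \<open>Discrete duality of divergence and gradient: the sum of both sides is a sum of edge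
  terms that cancel in pairs.\<close>

lemma sum_div_eq_neg_sum_grad:
  "(\<Sum>K\<in>\<T>. measure lebesgue K * (q K * mesh_div l \<T> w K)) =
   - (\<Sum>K\<in>\<T>. measure lebesgue K * (mesh_grad l \<T> q K \<bullet> w K))"
proof -
  let ?m = "edge_measure l" and ?n = "neighbour l \<T>" and ?\<nu> = "normal l"
  have d: "measure lebesgue K * (q K * mesh_div l \<T> w K) =
      (\<Sum>\<sigma>\<in>edges l K. q K * (?m K \<sigma> * flux l \<T> w K \<sigma>))" if "K \<in> \<T>" for K
    using measure_mesh_cell_pos[OF that] by (simp add: mesh_div_def sum_distrib_left)
  have g: "measure lebesgue K * (mesh_grad l \<T> q K \<bullet> w K) =
      (\<Sum>\<sigma>\<in>edges l K. ?m K \<sigma> * ((q (?n K \<sigma>) - q K) / 2) * (?\<nu> K \<sigma> \<bullet> w K))" if "K \<in> \<T>" for K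
    using measure_mesh_cell_pos[OF that] by (simp add: mesh_grad_def inner_sum_left)
  \<comment> \<open>The terms with \<open>q K *\<^sub>R w K\<close> cancel. What is left is
    symmetric in the two cells of an edge, and its product with the normal is antisymmetric.\<close>
  have "(\<Sum>K\<in>\<T>. measure lebesgue K * (q K * mesh_div l \<T> w K)) +
      (\<Sum>K\<in>\<T>. measure lebesgue K * (mesh_grad l \<T> q K \<bullet> w K)) =
      (\<Sum>K\<in>\<T>. \<Sum>\<sigma>\<in>edges l K. ?m K \<sigma> / 2 * ((q K *\<^sub>R w (?n K \<sigma>) + q (?n K \<sigma>) *\<^sub>R w K) \<bullet> ?\<nu> K \<sigma>))"
    unfolding sum.distrib[symmetric]
  proof (rule sum.cong[OF refl])
    fix K assume K: "K \<in> \<T>"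
    show "measure lebesgue K * (q K * mesh_div l \<T> w K) + measure lebesgue K * (mesh_grad l \<T> q K \<bullet> w K)
      = (\<Sum>\<sigma>\<in>edges l K. ?m K \<sigma> / 2 * ((q K *\<^sub>R w (?n K \<sigma>) + q (?n K \<sigma>) *\<^sub>R w K) \<bullet> ?\<nu> K \<sigma>))"
      unfolding d[OF K] g[OF K] sum.distrib[symmetric]
      by (rule sum.cong[OF refl])
        (simp add: flux_def inner_add_left inner_commute[of "?\<nu> K _"] field_simps)
  qed
  also have "\<dots> = 0"
    by (rule sum_edges_antisym) (simp add: neighbour add.commute)
  finally show ?thesis by simp
qed

section \<open>The energy estimate\<close>

context
  fixes w V :: "'a set \<Rightarrow> 'a" and wp wm :: "'a set \<Rightarrow> 'a set \<Rightarrow> real"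
  assumes split: "\<And>K \<sigma>. K \<in> \<T> \<Longrightarrow> \<sigma> \<in> edges l K \<Longrightarrow> wp K \<sigma> + wm K \<sigma> = flux l \<T> w K \<sigma>"
    and antisym: "\<And>K \<sigma>. K \<in> \<T> \<Longrightarrow> \<sigma> \<in> edges l K \<Longrightarrow> wp (neighbour l \<T> K \<sigma>) \<sigma> = - wm K \<sigma>"
    and nonpos: "\<And>K \<sigma>. K \<in> \<T> \<Longrightarrow> \<sigma> \<in> edges l K \<Longrightarrow> wm K \<sigma> \<le> 0"
    and div0: "\<And>K. K \<in> \<T> \<Longrightarrow> mesh_div l \<T> w K = 0"
begin

lemma sum_edge_flux_eq_0:
  assumes "K \<in> \<T>"
  shows "(\<Sum>\<sigma>\<in>edges l K. edge_measure l K \<sigma> * (wp K \<sigma> + wm K \<sigma>)) = 0"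
proof -
  have "(\<Sum>\<sigma>\<in>edges l K. edge_measure l K \<sigma> * flux l \<T> w K \<sigma>) = 0"
    using div0[OF assms] measure_mesh_cell_pos[OF assms] unfolding mesh_div_def by simp
  then show ?thesis using split[OF assms] by simp
qed

text \<open>Subtracting \<open>V K\<close> times the total flux out of the cell, which is zero,
  replaces the neighbouring values by jumps and leaves only the weights \<open>wm\<close>.\<close>

lemma div_up_eq_sum_jumps:
  assumes "K \<in> \<T>"
  shows "measure lebesgue K *\<^sub>R mesh_div_up l \<T> V wp wm K =
    (\<Sum>\<sigma>\<in>edges l K. (edge_measure l K \<sigma> * wm K \<sigma>) *\<^sub>R (V (neighbour l \<T> K \<sigma>) - V K))"
proof -
  have "measure lebesgue K *\<^sub>R mesh_div_up l \<T> V wp wm K =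
    (\<Sum>\<sigma>\<in>edges l K. (edge_measure l K \<sigma> * wm K \<sigma>) *\<^sub>R (V (neighbour l \<T> K \<sigma>) - V K)
       + (edge_measure l K \<sigma> * (wp K \<sigma> + wm K \<sigma>)) *\<^sub>R V K)"
    using measure_mesh_cell_pos[OF assms] by (simp add: mesh_div_up_def algebra_simps)
  then show ?thesis
    using sum_edge_flux_eq_0[OF assms] by (simp add: sum.distrib flip: scaleR_sum_left)
qed

lemma sum_inner_div_up:
  "(\<Sum>K\<in>\<T>. measure lebesgue K * (V K \<bullet> mesh_div_up l \<T> V wp wm K)) = (\<Sum>K\<in>\<T>. jump_energy l \<T> V wm K) / 2"
proof -
  let ?m = "edge_measure l" and ?n = "neighbour l \<T>"
  \<comment> \<open>The part of the edge terms that changes sign when seen from the other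
    cell.\<close>
  let ?F = "\<lambda>K \<sigma>. ?m K \<sigma> * (wm K \<sigma> * (norm (V (?n K \<sigma>)))\<^sup>2 + wp K \<sigma> * (norm (V K))\<^sup>2)"
  have "2 * (measure lebesgue K * (V K \<bullet> mesh_div_up l \<T> V wp wm K)) =
      jump_energy l \<T> V wm K + (\<Sum>\<sigma>\<in>edges l K. ?F K \<sigma>)" if K: "K \<in> \<T>" for K
  proof -
    have "2 * (measure lebesgue K * (V K \<bullet> mesh_div_up l \<T> V wp wm K)) =
        2 * (V K \<bullet> (measure lebesgue K *\<^sub>R mesh_div_up l \<T> V wp wm K))" by simp
    also have "\<dots> = (\<Sum>\<sigma>\<in>edges l K. (?m K \<sigma> * wm K \<sigma>) * (2 * (V K \<bullet> (V (?n K \<sigma>) - V K))))"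
      unfolding div_up_eq_sum_jumps[OF K] by (simp add: inner_sum_right sum_distrib_left mult_ac)
    \<comment> \<open>The polarization identity \<open>jump\<close> is applied and
      \<open>wp K \<sigma>\<close> times the square of the norm of \<open>V K\<close> is added and
      subtracted. This completes \<open>?F\<close>, and the last term sums to zero over the edges of
      the cell.\<close>
    also have "\<dots> = (\<Sum>\<sigma>\<in>edges l K.
        (?m K \<sigma> * - wm K \<sigma>) * (norm (V (?n K \<sigma>) - V K))\<^sup>2 + ?F K \<sigma>
        - ?m K \<sigma> * (wp K \<sigma> + wm K \<sigma>) * (norm (V K))\<^sup>2)"
    proof (rule sum.cong[OF refl])
      fix \<sigma>
      have jump: "2 * (V K \<bullet> (V (?n K \<sigma>) - V K)) =
          (norm (V (?n K \<sigma>)))\<^sup>2 - (norm (V K))\<^sup>2 - (norm (V (?n K \<sigma>) - V K))\<^sup>2"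
        by (simp add: power2_norm_eq_inner inner_diff_left inner_diff_right inner_commute)
      show "(?m K \<sigma> * wm K \<sigma>) * (2 * (V K \<bullet> (V (?n K \<sigma>) - V K))) =
          (?m K \<sigma> * - wm K \<sigma>) * (norm (V (?n K \<sigma>) - V K))\<^sup>2 + ?F K \<sigma>
          - ?m K \<sigma> * (wp K \<sigma> + wm K \<sigma>) * (norm (V K))\<^sup>2"
        unfolding jump by (simp add: ring_distribs)
    qed
    also have "\<dots> = jump_energy l \<T> V wm K + (\<Sum>\<sigma>\<in>edges l K. ?F K \<sigma>)"
      using sum_edge_flux_eq_0[OF K]
      by (simp add: jump_energy_def sum.distrib sum_subtractf sum_negf flip: sum_distrib_right)
    finally show ?thesis .
  qed
  then have "2 * (\<Sum>K\<in>\<T>. measure lebesgue K * (V K \<bullet> mesh_div_up l \<T> V wp wm K)) =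
      (\<Sum>K\<in>\<T>. jump_energy l \<T> V wm K) + (\<Sum>K\<in>\<T>. \<Sum>\<sigma>\<in>edges l K. ?F K \<sigma>)"
    unfolding sum_distrib_left sum.distrib[symmetric] by (rule sum.cong[OF refl])
  moreover have "(\<Sum>K\<in>\<T>. \<Sum>\<sigma>\<in>edges l K. ?F K \<sigma>) = 0"
  proof (rule sum_edges_antisym)
    fix K \<sigma> assume K: "K \<in> \<T>" "\<sigma> \<in> edges l K"
    have "wp K \<sigma> = - wm (?n K \<sigma>) \<sigma>"
      using antisym[OF neighbour(1,3)[OF K]] neighbour(4)[OF K] by simp
    then show "?F (?n K \<sigma>) \<sigma> = - ?F K \<sigma>"
      using antisym[OF K] neighbour(4,6)[OF K] by (simp add: algebra_simps)
  qed
  ultimately show ?thesis by simp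
qed

text \<open>Weighted Cauchy-Schwarz for the jump form; the overall sign of the weights disappears in
  the norm. The first factor is the sum that occurs in the time step condition.\<close>

lemma norm_div_up_squared_le:
  assumes "K \<in> \<T>"
  shows "(measure lebesgue K)\<^sup>2 * (norm (mesh_div_up l \<T> V wp wm K))\<^sup>2 \<le>
    (\<Sum>\<sigma>\<in>edges l K. edge_measure l K \<sigma> * - wm K \<sigma>) * jump_energy l \<T> V wm K"
proof -
  have "(measure lebesgue K)\<^sup>2 * (norm (mesh_div_up l \<T> V wp wm K))\<^sup>2 =
      (norm (measure lebesgue K *\<^sub>R mesh_div_up l \<T> V wp wm K))\<^sup>2"
    by (simp add: power_mult_distrib)
  also have "\<dots> = (norm (\<Sum>\<sigma>\<in>edges l K.
      (edge_measure l K \<sigma> * - wm K \<sigma>) *\<^sub>R (V (neighbour l \<T> K \<sigma>) - V K)))\<^sup>2"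
    unfolding div_up_eq_sum_jumps[OF assms] by (simp add: sum_negf)
  also have "\<dots> \<le> (\<Sum>\<sigma>\<in>edges l K. edge_measure l K \<sigma> * - wm K \<sigma>) * jump_energy l \<T> V wm K"
    unfolding jump_energy_def
    by (rule norm_weighted_sum_squared_le)
      (simp add: nonpos[OF assms] edge_measure_nonneg mult_nonneg_nonpos)
  finally show ?thesis .
qed

lemma jump_energy_nonneg:
  assumes "K \<in> \<T>"
  shows "0 \<le> jump_energy l \<T> V wm K"
  unfolding jump_energy_def
  by (intro sum_nonneg mult_nonneg_nonneg) (simp_all add: nonpos[OF assms] edge_measure_nonneg)

end

text \<open>One time step, from \<open>V\<close> to \<open>V'\<close> with new pressure
  \<open>q\<close>; the estimate does not couple different steps.\<close>

lemma scheme_energy_inequality: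
  fixes V V' :: "'a set \<Rightarrow> 'a" and q :: "'a set \<Rightarrow> real" and \<eta> \<delta>t :: real
  defines "dv \<equiv> stab l \<T> \<eta> \<delta>t q"
  assumes \<eta>: "1 \<le> \<eta>" and \<delta>t: "0 < \<delta>t"
    and div0: "\<And>K. K \<in> \<T> \<Longrightarrow> mesh_div l \<T> (\<lambda>L. V L - dv L) K = 0"
    and step: "\<And>K. K \<in> \<T> \<Longrightarrow> (1 / \<delta>t) *\<^sub>R (V' K - V K)
      + mesh_div_up l \<T> V (flux_pos l \<T> V dv) (flux_neg l \<T> V dv) K + mesh_grad l \<T> q K = 0"
    and cfl: "\<And>K. K \<in> \<T> \<Longrightarrow> time_step_condition l \<T> \<eta> \<delta>t V q K"
  shows "(\<Sum>K\<in>\<T>. measure lebesgue K * (norm (V' K))\<^sup>2) \<le> (\<Sum>K\<in>\<T>. measure lebesgue K * (norm (V K))\<^sup>2)"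
proof -
  let ?wp = "flux_pos l \<T> V dv" and ?wm = "flux_neg l \<T> V dv" and ?w = "\<lambda>L. V L - dv L"
  \<comment> \<open>The parts are built from two separate fluxes and need not be \<open>pos\<close>
    and \<open>neg\<close> of the total flux. The upwind results rely only on the sum, the
    antisymmetry, the sign and the vanishing divergence.\<close>
  have split: "?wp K \<sigma> + ?wm K \<sigma> = flux l \<T> ?w K \<sigma>" for K \<sigma>
    unfolding flux_pos_def flux_neg_def pos_def neg_def flux_def
    by (simp add: inner_add_left inner_diff_left field_simps)
  have antisym: "?wp (neighbour l \<T> K \<sigma>) \<sigma> = - ?wm K \<sigma>" if "K \<in> \<T>" "\<sigma> \<in> edges l K" for K \<sigma>
    unfolding flux_pos_def flux_neg_def flux_neighbour[OF that] pos_def neg_def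
    by (simp add: field_simps)
  have nonpos: "?wm K \<sigma> \<le> 0" for K \<sigma>
    unfolding flux_neg_def pos_def neg_def by (simp add: field_simps)
  note upwind = split antisym nonpos div0
  define M where "M K = measure lebesgue K" for K :: "'a set"
  define A where "A = mesh_div_up l \<T> V ?wp ?wm"
  define G where "G = mesh_grad l \<T> q"
  define D where "D = jump_energy l \<T> V ?wm"
  define S where "S K = (\<Sum>\<sigma>\<in>edges l K. edge_measure l K \<sigma> * - ?wm K \<sigma>)" for K
  have cell: "M K * (norm (V' K))\<^sup>2 \<le> M K * (norm (V K))\<^sup>2 - 2 * \<delta>t * (M K * (V K \<bullet> A K))
      - 2 * \<delta>t * (M K * (V K \<bullet> G K)) + \<delta>t * D K + 2 * \<delta>t\<^sup>2 * (M K * (norm (G K))\<^sup>2)"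
    if K: "K \<in> \<T>" for K
  proof -
    have M: "0 < M K" unfolding M_def by (rule measure_mesh_cell_pos[OF K])
    have D: "0 \<le> D K" unfolding D_def using jump_energy_nonneg[OF upwind K] by blast
    have S: "(M K)\<^sup>2 * (norm (A K))\<^sup>2 \<le> S K * D K"
      unfolding M_def A_def S_def D_def by (rule norm_div_up_squared_le[OF upwind K])
    have "S K \<noteq> 0 \<longrightarrow> \<delta>t \<le> M K / (2 * S K)"
      using cfl[OF K] unfolding time_step_condition_def Let_def S_def M_def dv_def .
    moreover have "0 \<le> S K" unfolding S_def
      using nonpos edge_measure_nonneg by (intro sum_nonneg mult_nonneg_nonneg) auto
    \<comment> \<open>If \<open>S K\<close> vanishes, the time step condition says nothing, but this
      form of it holds trivially.\<close>
    ultimately have "2 * \<delta>t * S K \<le> M K"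
      using M by (cases "S K = 0") (auto simp: field_simps)
    \<comment> \<open>Combined with Cauchy-Schwarz before the factor \<open>M K\<close> is
      cancelled, so that no division by \<open>S K\<close> occurs.\<close>
    then have "2 * \<delta>t * S K * D K \<le> M K * D K" using D by (rule mult_right_mono)
    moreover have "2 * \<delta>t * ((M K)\<^sup>2 * (norm (A K))\<^sup>2) \<le> 2 * \<delta>t * (S K * D K)"
      using S \<delta>t by (intro mult_left_mono) auto
    ultimately have "M K * (2 * \<delta>t * (M K * (norm (A K))\<^sup>2)) \<le> M K * D K"
      by (simp add: power2_eq_square mult_ac)
    then have "2 * \<delta>t * (M K * (norm (A K))\<^sup>2) \<le> D K" using M by simp
    then have "\<delta>t * (2 * \<delta>t * (M K * (norm (A K))\<^sup>2)) \<le> \<delta>t * D K" using \<delta>t by simp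
    then have bound: "2 * \<delta>t\<^sup>2 * (M K * (norm (A K))\<^sup>2) \<le> \<delta>t * D K"
      by (simp add: power2_eq_square mult_ac)
    have "\<delta>t *\<^sub>R ((1 / \<delta>t) *\<^sub>R (V' K - V K) + A K + G K) = 0"
      using step[OF K] unfolding A_def G_def by simp
    then have V': "V' K = V K - \<delta>t *\<^sub>R (A K + G K)"
      using \<delta>t by (simp add: algebra_simps)
    \<comment> \<open>The parallelogram law. Its factor 2 on the convective part is absorbed by the
      2 in the time step condition.\<close>
    have "(norm (A K + G K))\<^sup>2 + (norm (A K - G K))\<^sup>2 = 2 * (norm (A K))\<^sup>2 + 2 * (norm (G K))\<^sup>2"
      by (simp add: power2_norm_eq_inner inner_simps)
    then have "(norm (A K + G K))\<^sup>2 \<le> 2 * (norm (A K))\<^sup>2 + 2 * (norm (G K))\<^sup>2"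
      using zero_le_power2[of "norm (A K - G K)"] by linarith
    then have "\<delta>t\<^sup>2 * M K * (norm (A K + G K))\<^sup>2 \<le>
        \<delta>t\<^sup>2 * M K * (2 * (norm (A K))\<^sup>2 + 2 * (norm (G K))\<^sup>2)"
      using M by (intro mult_left_mono) auto
    moreover have "M K * (norm (V' K))\<^sup>2 = M K * (norm (V K))\<^sup>2 - 2 * \<delta>t * (M K * (V K \<bullet> A K))
      - 2 * \<delta>t * (M K * (V K \<bullet> G K)) + \<delta>t\<^sup>2 * M K * (norm (A K + G K))\<^sup>2"
      unfolding V' power2_norm_eq_inner
      by (simp add: inner_simps inner_commute power2_eq_square algebra_simps)
    ultimately show ?thesis using bound by (simp add: algebra_simps)
  qed
  have convection: "2 * (\<Sum>K\<in>\<T>. M K * (V K \<bullet> A K)) = (\<Sum>K\<in>\<T>. D K)"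
    unfolding M_def A_def D_def using sum_inner_div_up[OF upwind, of V] by linarith
  \<comment> \<open>Write \<open>V\<close> as \<open>?w\<close> plus \<open>dv\<close>: the first is
    divergence free and hence orthogonal to the gradient by duality, the second is \<eta> \<delta>t
    times the gradient itself.\<close>
  have pressure: "(\<Sum>K\<in>\<T>. M K * (V K \<bullet> G K)) = \<eta> * \<delta>t * (\<Sum>K\<in>\<T>. M K * (norm (G K))\<^sup>2)"
  proof -
    have w: "M K * (V K \<bullet> G K) - \<eta> * \<delta>t * (M K * (norm (G K))\<^sup>2) = M K * (G K \<bullet> ?w K)" for K
      unfolding dv_def stab_def G_def[symmetric]
      by (simp add: inner_diff_right inner_commute power2_norm_eq_inner right_diff_distrib)
    have "(\<Sum>K\<in>\<T>. M K * (G K \<bullet> ?w K)) = - (\<Sum>K\<in>\<T>. M K * (q K * mesh_div l \<T> ?w K))"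
      unfolding M_def G_def sum_div_eq_neg_sum_grad by simp
    also have "\<dots> = 0" using div0 by simp
    finally have "(\<Sum>K\<in>\<T>. M K * (V K \<bullet> G K) - \<eta> * \<delta>t * (M K * (norm (G K))\<^sup>2)) = 0"
      unfolding w .
    then show ?thesis by (simp add: sum_subtractf sum_distrib_left)
  qed
  have "(\<Sum>K\<in>\<T>. M K * (norm (V' K))\<^sup>2) \<le>
      (\<Sum>K\<in>\<T>. M K * (norm (V K))\<^sup>2 - 2 * \<delta>t * (M K * (V K \<bullet> A K))
        - 2 * \<delta>t * (M K * (V K \<bullet> G K)) + \<delta>t * D K + 2 * \<delta>t\<^sup>2 * (M K * (norm (G K))\<^sup>2))"
    by (rule sum_mono) (rule cell)
  also have "\<dots> = (\<Sum>K\<in>\<T>. M K * (norm (V K))\<^sup>2) - \<delta>t * (2 * (\<Sum>K\<in>\<T>. M K * (V K \<bullet> A K)))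
      - 2 * \<delta>t * (\<Sum>K\<in>\<T>. M K * (V K \<bullet> G K)) + \<delta>t * (\<Sum>K\<in>\<T>. D K)
      + 2 * \<delta>t\<^sup>2 * (\<Sum>K\<in>\<T>. M K * (norm (G K))\<^sup>2)"
    by (simp add: sum.distrib sum_subtractf sum_distrib_left mult_ac)
  \<comment> \<open>The convective term cancels the dissipation \<open>D\<close> exactly. The
    gradient has the coefficient -2 \<eta> from the pressure term and +2 from the remainder, each
    times the square of \<delta>t.\<close>
  also have "\<dots> = (\<Sum>K\<in>\<T>. M K * (norm (V K))\<^sup>2)
      - 2 * \<delta>t\<^sup>2 * (\<eta> - 1) * (\<Sum>K\<in>\<T>. M K * (norm (G K))\<^sup>2)"
    unfolding convection pressure by (simp add: power2_eq_square algebra_simps)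
  also have "\<dots> \<le> (\<Sum>K\<in>\<T>. M K * (norm (V K))\<^sup>2)"
    using \<eta> by (simp add: M_def sum_nonneg)
  finally show ?thesis unfolding M_def .
qed

end

theorem theorem6p11:
  fixes l :: "'a::euclidean_space" and \<T> :: "'a set set"
    and \<eta> \<delta>t T :: real and N :: nat
    and v0 :: "'a \<Rightarrow> 'a" and v :: "nat \<Rightarrow> 'a set \<Rightarrow> 'a" and p :: "nat \<Rightarrow> 'a set \<Rightarrow> real"
  assumes "DIM('a) = 2 \<or> DIM('a) = 3"
    and "periodic_mesh l \<T>"
    and "0 < T" and "0 < \<delta>t" and "real N * \<delta>t = T"
    and "periodic_integrable l v0"
    and "limit_scheme l \<T> \<eta> \<delta>t N v0 v p"
    and "1 < \<eta>"
    and "\<forall>n<N. \<forall>K\<in>\<T>. time_step_condition l \<T> \<eta> \<delta>t (v n) (p (Suc n)) K"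
  shows "\<forall>n<N. 1/2 * (\<Sum>K\<in>\<T>. measure lebesgue K * (norm (v (Suc n) K))\<^sup>2)
             \<le> 1/2 * (\<Sum>K\<in>\<T>. measure lebesgue K * (norm (v n K))\<^sup>2)"
proof (intro allI impI mult_left_mono)
  fix n assume "n < N"
  with assms(4,7-9) show "(\<Sum>K\<in>\<T>. measure lebesgue K * (norm (v (Suc n) K))\<^sup>2)
      \<le> (\<Sum>K\<in>\<T>. measure lebesgue K * (norm (v n K))\<^sup>2)"
    by (intro scheme_energy_inequality[OF assms(2), of \<eta> \<delta>t "v n" "p (Suc n)"])
      (auto simp: limit_scheme_def Let_def)
qed simp

end
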